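(* For every diagram $D$, \[\mathrm{mc}(D)=|\mathrm{empty}(D)|-\max_{\widehat D\in\mathrm{Min}(D)}|\mathrm{empty}(\widehat D)|.\]
   Context: A diagram is a finite subset $D\subset\mathbb{Z}_{>0}\times\mathbb{Z}_{>0}$; $(r,c)\in D$ is a cell in row $r$, column $c$. $\mathrm{empty}(D)=\{(r,c)\notin D : \exists\,\tilde r>r \text{ with } (\tilde r,c)\in D\}$. Kohnert move at row $r$: if row $r$ is empty, $\mathcal{K}(D,r)=D$; otherwise let $(r,c)$ be the rightmost cell of row $r$; if some $r'<r$ has $(r',c)\notin D$, take the largest such $r'$ and set $\mathcal{K}(D,r)=(D\setminus\{(r,c)\})\cup\{(r',c)\}$; else $\mathcal{K}(D,r)=D$. A move is nontrivial if $\mathcal{K}(D,r)\ne D$. $\mathrm{KD}(D)$ is the set of diagrams obtainable from $D$ by finite sequences of Kohnert moves, and $\mathrm{Min}(D)=\{\tilde D\in\mathrm{KD}(D):\mathcal{K}(\tilde D,r)=\tilde D\ \forall r\}$. $\mathrm{mc}(D)$ is the minimum, over all $\tilde D\in\mathrm{Min}(D)$ and all sequences of nontrivial Kohnert moves transforming $D$ into $\tilde D$, of the number of moves. *)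

theory Defs
  imports Main
begin

text \<open>A cell \<open>(r, c)\<close> lies in row \<open>r\<close> and column \<open>c\<close>; rows and columns are numbered from 1.\<close>

definition diagram :: "(nat \<times> nat) set \<Rightarrow> bool" where
  "diagram D \<longleftrightarrow> finite D \<and> (\<forall>(r, c) \<in> D. 0 < r \<and> 0 < c)"

definition empty_cells :: "(nat \<times> nat) set \<Rightarrow> (nat \<times> nat) set" where
  "empty_cells D = {(r, c). 0 < r \<and> 0 < c \<and> (r, c) \<notin> D \<and> (\<exists>r'>r. (r', c) \<in> D)}"

definition kohnert_move :: "(nat \<times> nat) set \<Rightarrow> nat \<Rightarrow> (nat \<times> nat) set" where
  "kohnert_move D r =
    (if {c. (r, c) \<in> D} = {} then D
     else let c = Max {c. (r, c) \<in> D};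
              free = {r'. 0 < r' \<and> r' < r \<and> (r', c) \<notin> D}
          in if free = {} then D else (D - {(r, c)}) \<union> {(Max free, c)})"

inductive_set KD :: "(nat \<times> nat) set \<Rightarrow> (nat \<times> nat) set set"
  for D :: "(nat \<times> nat) set" where
  refl: "D \<in> KD D"
| move: "E \<in> KD D \<Longrightarrow> 0 < r \<Longrightarrow> kohnert_move E r \<in> KD D"

definition Min_KD :: "(nat \<times> nat) set \<Rightarrow> (nat \<times> nat) set set" where
  "Min_KD D = {E \<in> KD D. \<forall>r>0. kohnert_move E r = E}"

definition nontrivial_move :: "((nat \<times> nat) set \<times> (nat \<times> nat) set) set" where
  "nontrivial_move = {(E, F). \<exists>r>0. F = kohnert_move E r \<and> F \<noteq> E}"

definition mc :: "(nat \<times> nat) set \<Rightarrow> nat" where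
  "mc D = (LEAST n. \<exists>E \<in> Min_KD D. (D, E) \<in> nontrivial_move ^^ n)"

text \<open>
  For a diagram \<open>D\<close>, the set \<open>Min_KD D\<close> is finite and nonempty, all sets \<open>empty_cells E\<close>
  are finite, and some \<open>n\<close> satisfies the condition in the definition of \<open>mc\<close>. Hence
  \<open>Max\<close> over \<open>Min_KD D\<close>, \<open>card\<close> and \<open>LEAST\<close> have their intended meaning.
\<close>

lemma kohnert_move_cases:
  assumes "diagram D"
  obtains "kohnert_move D r = D"
  | c q where "(r, c) \<in> D" "0 < q" "q < r" "(q, c) \<notin> D"
      "kohnert_move D r = (D - {(r, c)}) \<union> {(q, c)}"
proof (cases "kohnert_move D r = D")
  case False
  define c where "c = Max {c. (r, c) \<in> D}"
  define S where "S = {r'. 0 < r' \<and> r' < r \<and> (r', c) \<notin> D}"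
  have ne: "{c. (r, c) \<in> D} \<noteq> {}" "S \<noteq> {}"
    using False by (auto simp: kohnert_move_def c_def S_def Let_def split: if_splits)
  have eq: "kohnert_move D r = (D - {(r, c)}) \<union> {(Max S, c)}"
    using ne unfolding kohnert_move_def Let_def c_def[symmetric] S_def[symmetric]
    by (simp only: if_False)
  have "{c. (r, c) \<in> D} \<subseteq> snd ` D" by force
  then have "finite {c. (r, c) \<in> D}"
    using assms finite_subset unfolding diagram_def by blast
  then have "c \<in> {c. (r, c) \<in> D}" unfolding c_def using ne(1) Max_in by blast
  moreover have "Max S \<in> S" using ne(2) by (intro Max_in) (auto simp: S_def)
  ultimately show ?thesis using eq that(2) unfolding S_def by blast
qed (use that in blast)

lemma diagram_kohnert_move:
  assumes "diagram D"
  shows "diagram (kohnert_move D r)"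
  using assms by (rule kohnert_move_cases[of D r]) (use assms in \<open>auto simp: diagram_def\<close>)

lemma KD_bounded:
  assumes "E \<in> KD D" "diagram D"
  shows "diagram E \<and> E \<subseteq> {..Max (fst ` D)} \<times> snd ` D"
  using assms(1)
proof induction
  case refl
  have "E \<subseteq> {..Max (fst ` E)} \<times> snd ` E" if "finite E" for E :: "(nat \<times> nat) set"
    using that by (force intro: Max_ge)
  with assms(2) show ?case by (auto simp: diagram_def)
next
  case (move E r)
  then have E: "diagram E" by blast
  have "kohnert_move E r \<subseteq> {..Max (fst ` D)} \<times> snd ` D"
    using E by (rule kohnert_move_cases[of E r]) (use move.IH in fastforce)+
  with diagram_kohnert_move[OF E] show ?case by blast
qed

lemma finite_KD:
  assumes "diagram D"
  shows "finite (KD D)"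
proof (rule finite_subset)
  show "KD D \<subseteq> Pow ({..Max (fst ` D)} \<times> snd ` D)"
    using KD_bounded assms by blast
  show "finite (Pow ({..Max (fst ` D)} \<times> snd ` D))"
    using assms by (simp add: diagram_def)
qed

lemma finite_Min_KD: "diagram D \<Longrightarrow> finite (Min_KD D)"
  using finite_KD unfolding Min_KD_def by simp

lemma finite_empty_cells:
  assumes "diagram D"
  shows "finite (empty_cells D)"
proof (rule finite_subset)
  show "empty_cells D \<subseteq> (\<Union>(r, c) \<in> D. {..r} \<times> {c})"
    by (auto simp: empty_cells_def)
  show "finite (\<Union>(r, c) \<in> D. {..r} \<times> {c})"
    using assms by (auto simp: diagram_def)
qed

lemma sum_rows_decreases:
  assumes "diagram E" "(E, F) \<in> nontrivial_move"
  shows "sum fst F < sum fst E"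
proof -
  obtain r where r: "F = kohnert_move E r" "F \<noteq> E"
    using assms(2) by (auto simp: nontrivial_move_def)
  obtain c q where *: "(r, c) \<in> E" "0 < q" "q < r" "(q, c) \<notin> E"
      "kohnert_move E r = (E - {(r, c)}) \<union> {(q, c)}"
    using assms(1) by (rule kohnert_move_cases[of E r]) (use r in auto)
  have fin: "finite E" using assms(1) by (simp add: diagram_def)
  have "sum fst F = q + sum fst (E - {(r, c)})" using * r fin by simp
  moreover have "sum fst E = r + sum fst (E - {(r, c)})"
    using sum.remove[OF fin *(1), of fst] by simp
  ultimately show ?thesis using *(3) by simp
qed

lemma nontrivial_path_to_Min_KD:
  assumes "diagram D"
  shows "\<exists>n. \<exists>E \<in> Min_KD D. (D, E) \<in> nontrivial_move ^^ n"
proof -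
  have "\<exists>n. \<exists>F \<in> Min_KD D. (E, F) \<in> nontrivial_move ^^ n" if "E \<in> KD D" for E
    using that
  proof (induction "sum fst E" arbitrary: E rule: less_induct)
    case less
    show ?case
    proof (cases "E \<in> Min_KD D")
      case True
      then have "\<exists>F \<in> Min_KD D. (E, F) \<in> nontrivial_move ^^ 0" by simp
      then show ?thesis by blast
    next
      case False
      then obtain r where r: "0 < r" "kohnert_move E r \<noteq> E"
        using less.prems by (auto simp: Min_KD_def)
      let ?F = "kohnert_move E r"
      have step: "(E, ?F) \<in> nontrivial_move" using r by (auto simp: nontrivial_move_def)
      have "?F \<in> KD D" using less.prems r(1) by (rule KD.move)
      moreover have "sum fst ?F < sum fst E"
        using sum_rows_decreases step KD_bounded[OF less.prems assms] by blast
      ultimately obtain n G where "G \<in> Min_KD D" "(?F, G) \<in> nontrivial_move ^^ n"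
        using less.hyps by blast
      then show ?thesis using step relpow_Suc_I2 by metis
    qed
  qed
  then show ?thesis using KD.refl by blast
qed

lemma Min_KD_nonempty: "diagram D \<Longrightarrow> Min_KD D \<noteq> {}"
  using nontrivial_path_to_Min_KD by blast

end

theory Submission
  imports Defs
begin

text \<open>
  Let \<open>U E\<close> consist of the cells of \<open>E\<close> and the positions below them, so that
  \<open>|U E| = |empty E| + |E|\<close>. A nontrivial move removes at most one position from \<open>U\<close>, and it
  removes one exactly when the moved cell is the top of its column. Let \<open>n\<^sub>c\<close> be the number of cells
  in column \<open>c\<close>, which no move changes, and let \<open>B\<close> be the set of those \<open>(r, c)\<close> in \<open>U D\<close> with
  \<open>r \<le> n\<^bsub>c'\<^esub>\<close> for some \<open>c' \<ge> c\<close>. In a minimal diagram the rightmost cell of each row has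
  a full column below it, so \<open>U E \<subseteq> B\<close> for every minimal \<open>E\<close>. Conversely, always moving in the
  highest row that admits a nontrivial move moves only tops of columns and never removes a position
  of \<open>B\<close>, so it reaches a minimal diagram with \<open>U E = B\<close> in exactly \<open>|U D| - |B|\<close> moves.
\<close>

definition shadow :: "(nat \<times> nat) set \<Rightarrow> (nat \<times> nat) set" where
  "shadow E = {(r, c). 0 < r \<and> (\<exists>r'\<ge>r. (r', c) \<in> E)}"

definition column :: "(nat \<times> nat) set \<Rightarrow> nat \<Rightarrow> nat set" where
  "column E c = {r. (r, c) \<in> E}"

text \<open>The set \<open>B\<close> of the overview; \<open>shadow\<close> is its \<open>U\<close>.
  Apart from \<open>shadow E\<close>, it depends only on the column sizes, which moves
  preserve.\<close>

definition stable_shadow :: "(nat \<times> nat) set \<Rightarrow> (nat \<times> nat) set" where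
  "stable_shadow E = {(r, c) \<in> shadow E. \<exists>c'\<ge>c. r \<le> card (column E c')}"

lemma finite_row: "diagram E \<Longrightarrow> finite {c. (r, c) \<in> E}"
  by (rule finite_subset[of _ "snd ` E"]) (force simp: diagram_def)+

lemma finite_column: "diagram E \<Longrightarrow> finite (column E c)"
  by (rule finite_subset[of _ "fst ` E"]) (force simp: diagram_def column_def)+

lemma finite_shadow: "diagram E \<Longrightarrow> finite (shadow E)"
  by (rule finite_subset[of _ "\<Union>(r, c) \<in> E. {..r} \<times> {c}"])
    (auto simp: shadow_def diagram_def)

lemma shadow_eq:
  assumes "diagram E"
  shows "shadow E = empty_cells E \<union> E"
proof -
  have "0 < r \<and> 0 < c" if "(r, c) \<in> E" for r c
    using assms that by (auto simp: diagram_def)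
  then show ?thesis
    by (fastforce simp: shadow_def empty_cells_def le_less)
qed

lemma card_shadow:
  assumes "diagram E"
  shows "card (shadow E) = card (empty_cells E) + card E"
proof -
  have "empty_cells E \<inter> E = {}" by (auto simp: empty_cells_def)
  then show ?thesis
    using assms finite_empty_cells[OF assms]
    by (simp add: shadow_eq card_Un_disjoint diagram_def)
qed

section \<open>Nontrivial and trivial moves\<close>

text \<open>Refines \<open>kohnert_move_cases\<close>: \<open>c\<close> is rightmost in its row and,
  since \<open>q\<close> is the highest free position below \<open>r\<close>, everything strictly
  between them is filled.\<close>

lemma nontrivial_kohnert_moveE:
  assumes "diagram E" "kohnert_move E r \<noteq> E"
  obtains c q where "(r, c) \<in> E" "\<And>c'. (r, c') \<in> E \<Longrightarrow> c' \<le> c" "0 < q" "q < r"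
    "(q, c) \<notin> E" "\<And>s. q < s \<Longrightarrow> s < r \<Longrightarrow> (s, c) \<in> E"
    "kohnert_move E r = (E - {(r, c)}) \<union> {(q, c)}"
proof -
  define c where "c = Max {c. (r, c) \<in> E}"
  define S where "S = {r'. 0 < r' \<and> r' < r \<and> (r', c) \<notin> E}"
  have ne: "{c. (r, c) \<in> E} \<noteq> {}" "S \<noteq> {}"
    using assms(2) by (auto simp: kohnert_move_def c_def S_def Let_def split: if_splits)
  have eq: "kohnert_move E r = (E - {(r, c)}) \<union> {(Max S, c)}"
    using ne unfolding kohnert_move_def Let_def c_def[symmetric] S_def[symmetric]
    by (simp only: if_False)
  have c: "(r, c) \<in> E" "\<And>c'. (r, c') \<in> E \<Longrightarrow> c' \<le> c"
    using Max_in[OF finite_row[OF assms(1)] ne(1)] Max_ge[OF finite_row[OF assms(1)], of _ r]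
    unfolding c_def by auto
  have fin: "finite S" by (simp add: S_def)
  have S: "Max S \<in> S" using Max_in[OF fin ne(2)] .
  have filled: "(s, c) \<in> E" if "Max S < s" "s < r" for s
  proof -
    have "s \<notin> S" using Max_ge[OF fin, of s] that(1) by auto
    with that show ?thesis by (auto simp: S_def)
  qed
  \<comment> \<open>Only the second \<open>S\<close> in \<open>Max S \<in> S\<close> is unfolded, so
    that \<open>Max S\<close> stays folded.\<close>
  have "0 < Max S" "Max S < r" "(Max S, c) \<notin> E"
    using S by (subst (asm) (2) S_def, blast)+
  then show thesis using that c filled eq by blast
qed

text \<open>The rightmost cell of row \<open>r\<close> cannot move, so nothing is free below it; its
  column is \<open>c'\<close>.\<close>

lemma trivial_kohnert_move_full_column:
  assumes "diagram E" "kohnert_move E r = E" "(r, c) \<in> E"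
  obtains c' where "c \<le> c'" "{1..r} \<subseteq> column E c'"
proof -
  define c' where "c' = Max {c. (r, c) \<in> E}"
  define S where "S = {s. 0 < s \<and> s < r \<and> (s, c') \<notin> E}"
  have ne: "{c. (r, c) \<in> E} \<noteq> {}" using assms(3) by auto
  have c': "(r, c') \<in> E" "c \<le> c'"
    using Max_in[OF finite_row[OF assms(1)] ne] Max_ge[OF finite_row[OF assms(1)], of c r] assms(3)
    unfolding c'_def by auto
  have "S = {}"
  proof (rule ccontr)
    assume "S \<noteq> {}"
    then have "kohnert_move E r = (E - {(r, c')}) \<union> {(Max S, c')}"
      using ne unfolding kohnert_move_def Let_def c'_def[symmetric] S_def[symmetric]
      by (simp only: if_False)
    moreover have "Max S \<in> S"
      using \<open>S \<noteq> {}\<close> by (intro Max_in) (auto simp: S_def)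
    ultimately show False using assms(2) by (auto simp: S_def)
  qed
  then have "{1..r} \<subseteq> column E c'"
    using c'(1) by (force simp: S_def column_def le_less)
  with c'(2) show thesis by (rule that)
qed

lemma kohnert_move_invariants:
  assumes "diagram E"
  shows "card (kohnert_move E r) = card E"
    and "card (column (kohnert_move E r) d) = card (column E d)"
proof -
  have swap: "card ((A - {x}) \<union> {y}) = card A" if "finite A" "x \<in> A" "y \<notin> A" for A :: "'a set" and x y
    using that card.remove[OF that(1,2)] by simp
  have "card (kohnert_move E r) = card E \<and> card (column (kohnert_move E r) d) = card (column E d)"
    using assms
  proof (rule kohnert_move_cases[of E r])
    fix c q
    assume *: "(r, c) \<in> E" "0 < q" "q < r" "(q, c) \<notin> E"
      "kohnert_move E r = (E - {(r, c)}) \<union> {(q, c)}"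
    have "column (kohnert_move E r) d =
        (if d = c then (column E d - {r}) \<union> {q} else column E d)"
      by (auto simp: *(5) column_def)
    moreover have "finite E" using assms by (simp add: diagram_def)
    ultimately show ?thesis
      using * swap[of E "(r, c)" "(q, c)"] swap[OF finite_column[OF assms], of r c q]
      by (auto simp: column_def)
  qed simp
  then show "card (kohnert_move E r) = card E"
    and "card (column (kohnert_move E r) d) = card (column E d)" by blast+
qed

lemma shadow_kohnert_move_subset:
  assumes "diagram E"
  shows "shadow (kohnert_move E r) \<subseteq> shadow E"
  using assms
  by (rule kohnert_move_cases[of E r]) (auto simp: shadow_def, meson less_imp_le order_trans)

lemma KD_invariants:
  assumes "E \<in> KD D" "diagram D"
  shows "diagram E \<and> card E = card D \<and> (\<forall>c. card (column E c) = card (column D c)) \<and>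
    shadow E \<subseteq> shadow D"
  using assms(1)
proof induction
  case (move E r)
  then have "diagram E" by blast
  with move.IH show ?case
    using diagram_kohnert_move[of E r] kohnert_move_invariants[of E r]
      shadow_kohnert_move_subset[of E r] by auto
qed (use assms in simp)

text \<open>A position of \<open>shadow G\<close> lies at or below a cell whose row is stuck. That
  row meets a column weakly to the right that is full up to it, and column sizes are those of
  \<open>D\<close>.\<close>

lemma shadow_Min_KD_subset:
  assumes "G \<in> Min_KD D" "diagram D"
  shows "shadow G \<subseteq> stable_shadow D"
proof
  fix x assume x: "x \<in> shadow G"
  then obtain r c t where rc: "x = (r, c)" "0 < r" "r \<le> t" "(t, c) \<in> G"
    by (auto simp: shadow_def)
  have G: "G \<in> KD D" and triv: "kohnert_move G t = G"
    using assms(1) rc by (auto simp: Min_KD_def)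
  note inv = KD_invariants[OF G assms(2)]
  from inv have "diagram G" by blast
  then obtain c' where c': "c \<le> c'" "{1..t} \<subseteq> column G c'"
    using triv rc(4) by (rule trivial_kohnert_move_full_column)
  have "t \<le> card (column G c')"
    using card_mono[OF finite_column[OF \<open>diagram G\<close>] c'(2)] by simp
  then have "r \<le> card (column D c')" using inv rc(3) by simp
  with c'(1) x rc(1) inv show "x \<in> stable_shadow D" by (auto simp: stable_shadow_def)
qed

section \<open>Lower bound on the number of moves\<close>

text \<open>Only \<open>(r, c)\<close> can leave the shadow: positions strictly between
  \<open>q\<close> and \<open>r\<close> stay occupied, and those up to \<open>q\<close> lie at or
  below the new cell.\<close>

lemma card_shadow_le_Suc:
  assumes "diagram E" "(E, F) \<in> nontrivial_move"
  shows "card (shadow E) \<le> Suc (card (shadow F))"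
proof -
  obtain r where r: "F = kohnert_move E r" "kohnert_move E r \<noteq> E"
    using assms(2) by (auto simp: nontrivial_move_def)
  obtain c q where *: "q < r" "\<And>s. q < s \<Longrightarrow> s < r \<Longrightarrow> (s, c) \<in> E"
    "F = (E - {(r, c)}) \<union> {(q, c)}"
    using nontrivial_kohnert_moveE[OF assms(1) r(2)] r(1) by metis
  have "shadow E \<subseteq> insert (r, c) (shadow F)"
  proof
    fix x assume "x \<in> shadow E"
    then obtain s d t where x: "x = (s, d)" "0 < s" "s \<le> t" "(t, d) \<in> E"
      by (auto simp: shadow_def)
    show "x \<in> insert (r, c) (shadow F)"
    \<comment> \<open>In the negative case either \<open>(t, d)\<close> is an unmoved cell, or
      \<open>s = r\<close> and \<open>x\<close> is \<open>(r, c)\<close> itself.\<close>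
    proof (cases "(t, d) = (r, c) \<and> s < r")
      case True
      then have "(s, c) \<in> F \<or> s \<le> q" using *(2)[of s] *(3) by force
      then show ?thesis using x True *(3) by (auto simp: shadow_def)
    next
      case False
      then show ?thesis using x *(3) by (auto simp: shadow_def)
    qed
  qed
  moreover have "finite (shadow F)"
    using finite_shadow diagram_kohnert_move assms(1) r(1) by blast
  ultimately have "card (shadow E) \<le> card (insert (r, c) (shadow F))"
    by (intro card_mono) auto
  also have "\<dots> \<le> Suc (card (shadow F))" by (rule card_insert_le_m1) simp_all
  finally show ?thesis .
qed

lemma card_shadow_le_relpow:
  assumes "(E, F) \<in> nontrivial_move ^^ n" "diagram E"
  shows "card (shadow E) \<le> n + card (shadow F)"
  using assms
proof (induction n arbitrary: E)
  case (Suc n)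
  obtain H where H: "(E, H) \<in> nontrivial_move" "(H, F) \<in> nontrivial_move ^^ n"
    using Suc.prems(1) by (rule relpow_Suc_E2)
  have "diagram H"
    using H(1) Suc.prems(2) diagram_kohnert_move by (auto simp: nontrivial_move_def)
  then show ?case
    using Suc.IH[OF H(2)] card_shadow_le_Suc[OF Suc.prems(2) H(1)] by simp
qed simp

section \<open>Upper bound by moving in the highest possible row\<close>

lemma highest_kohnert_move:
  assumes "diagram E" "kohnert_move E r \<noteq> E" "\<And>s. r < s \<Longrightarrow> kohnert_move E s = E"
  obtains c where "(r, c) \<in> shadow E" "(r, c) \<notin> stable_shadow E"
    "shadow (kohnert_move E r) = shadow E - {(r, c)}"
proof -
  obtain c q where *: "(r, c) \<in> E" "\<And>c'. (r, c') \<in> E \<Longrightarrow> c' \<le> c" "0 < q" "q < r"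
    "(q, c) \<notin> E" "\<And>s. q < s \<Longrightarrow> s < r \<Longrightarrow> (s, c) \<in> E"
    "kohnert_move E r = (E - {(r, c)}) \<union> {(q, c)}"
    using nontrivial_kohnert_moveE[OF assms(1,2)] by metis
  \<comment> \<open>A cell above row \<open>r\<close> in a column \<open>d \<ge> c\<close> lies in a
    stuck row and yields a full column \<open>c' \<ge> d\<close> through rows \<open>q\<close> and
    \<open>r\<close>. As \<open>c\<close> is rightmost in row \<open>r\<close>,
    \<open>c' = c\<close>, but \<open>(q, c)\<close> is free.\<close>
  have right: "s \<le> r" if sd: "(s, d) \<in> E" "c \<le> d" for s d
  proof (rule ccontr)
    assume "\<not> s \<le> r"
    then have "r < s" by simp
    obtain c' where c': "d \<le> c'" "{1..s} \<subseteq> column E c'"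
      using trivial_kohnert_move_full_column[OF assms(1) assms(3)[OF \<open>r < s\<close>] sd(1)] by metis
    then have "(r, c') \<in> E" "(q, c') \<in> E"
      using \<open>r < s\<close> *(3,4) by (auto simp: column_def subset_iff)
    moreover from this have "c' = c" using *(2)[of c'] c'(1) sd(2) by simp
    ultimately show False using *(5) by simp
  qed
  have few: "card (column E d) < r" if "c \<le> d" for d
  proof -
    \<comment> \<open>A gap among the first \<open>r\<close> rows: \<open>q\<close> in column
      \<open>c\<close>, and \<open>r\<close> itself further right, where row \<open>r\<close> has no
      cells.\<close>
    define p where "p = (if d = c then q else r)"
    have "(p, d) \<notin> E" "p \<in> {1..r}"
      using *(2)[of d] *(3-5) that by (auto simp: p_def)
    moreover have "column E d \<subseteq> {1..r}"
      using right[OF _ that] assms(1) by (force simp: column_def diagram_def)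
    ultimately have "column E d \<subset> {1..r}" by (auto simp: column_def)
    then show ?thesis using psubset_card_mono[of "{1..r}"] by simp
  qed
  have "shadow (kohnert_move E r) = shadow E - {(r, c)}"
  proof (intro equalityI subsetI)
    fix x assume x: "x \<in> shadow (kohnert_move E r)"
    moreover have "(r, c) \<notin> shadow (kohnert_move E r)"
      using right[of _ c] *(4,7) by (fastforce simp: shadow_def)
    ultimately show "x \<in> shadow E - {(r, c)}"
      using shadow_kohnert_move_subset[OF assms(1), of r] by auto
  next
    fix x assume "x \<in> shadow E - {(r, c)}"
    then obtain s d t where x: "x = (s, d)" "0 < s" "s \<le> t" "(t, d) \<in> E" "(s, d) \<noteq> (r, c)"
      by (auto simp: shadow_def)
    show "x \<in> shadow (kohnert_move E r)"
    proof (cases "(t, d) = (r, c)")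
      case True
      then have "s < r" using x by auto
      then have "(s, c) \<in> kohnert_move E r \<or> s \<le> q" using *(6)[of s] *(7) by force
      then show ?thesis using x True *(7) by (auto simp: shadow_def)
    next
      case False
      then show ?thesis using x *(7) by (auto simp: shadow_def)
    qed
  qed
  moreover have "(r, c) \<in> shadow E" using *(1,4) by (auto simp: shadow_def)
  moreover have "(r, c) \<notin> stable_shadow E" using few by (force simp: stable_shadow_def)
  ultimately show thesis using that by blast
qed

text \<open>Each highest move shrinks the shadow by exactly one position outside
  \<open>stable_shadow D\<close>, so the path length equals the drop in shadow size.\<close>

lemma stable_shadow_path:
  assumes "diagram D" "E \<in> KD D" "stable_shadow D \<subseteq> shadow E"
  shows "\<exists>n. \<exists>G \<in> Min_KD D. (E, G) \<in> nontrivial_move ^^ n \<and> stable_shadow D \<subseteq> shadow G \<and>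
    card (shadow E) = n + card (shadow G)"
  using assms(2,3)
proof (induction "card (shadow E)" arbitrary: E rule: less_induct)
  case less
  note inv = KD_invariants[OF less.prems(1) assms(1)]
  then have E: "diagram E" by blast
  show ?case
  proof (cases "E \<in> Min_KD D")
    case True
    then have "(E, E) \<in> nontrivial_move ^^ 0 \<and> stable_shadow D \<subseteq> shadow E \<and>
        card (shadow E) = 0 + card (shadow E)"
      using less.prems by simp
    with True show ?thesis by blast
  next
    case False
    define R where "R = {r. 0 < r \<and> kohnert_move E r \<noteq> E}"
    have "R \<subseteq> fst ` E"
      by (auto simp: R_def elim!: nontrivial_kohnert_moveE[OF E] intro: rev_image_eqI)
    then have fin: "finite R" using E finite_subset by (auto simp: diagram_def)
    have "R \<noteq> {}" using False less.prems(1) by (auto simp: Min_KD_def R_def)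
    define r where "r = Max R"
    have r: "0 < r" "kohnert_move E r \<noteq> E"
      using Max_in[OF fin \<open>R \<noteq> {}\<close>] by (auto simp: r_def R_def)
    have top: "kohnert_move E s = E" if "r < s" for s
      using Max_ge[OF fin, of s] that by (force simp: r_def R_def)
    let ?F = "kohnert_move E r"
    obtain c where c: "(r, c) \<in> shadow E" "(r, c) \<notin> stable_shadow E"
      "shadow ?F = shadow E - {(r, c)}"
      using highest_kohnert_move[OF E r(2) top] by metis
    have card: "card (shadow E) = Suc (card (shadow ?F))"
      using card.remove[OF finite_shadow[OF E] c(1)] c(3) by simp
    \<comment> \<open>By equality of column sizes, the removed position, being outside
      \<open>stable_shadow E\<close>, is also outside \<open>stable_shadow D\<close>.\<close>
    have "stable_shadow D \<inter> shadow E \<subseteq> stable_shadow E"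
      using inv by (auto simp: stable_shadow_def)
    then have "stable_shadow D \<subseteq> shadow ?F" using less.prems(2) c by auto
    moreover have "?F \<in> KD D" using less.prems(1) r(1) by (rule KD.move)
    ultimately obtain n G where G: "G \<in> Min_KD D" "(?F, G) \<in> nontrivial_move ^^ n"
      "stable_shadow D \<subseteq> shadow G" "card (shadow ?F) = n + card (shadow G)"
      using less.hyps[of ?F] card by auto
    have "(E, ?F) \<in> nontrivial_move" using r by (auto simp: nontrivial_move_def)
    then have "(E, G) \<in> nontrivial_move ^^ Suc n" using G(2) by (rule relpow_Suc_I2)
    moreover have "card (shadow E) = Suc n + card (shadow G)" using card G(4) by simp
    ultimately show ?thesis using G(1,3) by blast
  qed
qed

theorem theorem4p8:
  fixes D :: "(nat \<times> nat) set"
  assumes "diagram D"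
  shows "int (mc D) = int (card (empty_cells D)) - int (Max ((\<lambda>E. card (empty_cells E)) ` Min_KD D))"
proof -
  have "stable_shadow D \<subseteq> shadow D" by (auto simp: stable_shadow_def)
  then obtain n G where G: "G \<in> Min_KD D" "(D, G) \<in> nontrivial_move ^^ n"
    "stable_shadow D \<subseteq> shadow G" "card (shadow D) = n + card (shadow G)"
    using stable_shadow_path[OF assms KD.refl] by blast
  have split: "card (shadow E) = card (empty_cells E) + card D" "diagram E" if "E \<in> Min_KD D" for E
    using KD_invariants[OF _ assms, of E] that card_shadow[of E] by (auto simp: Min_KD_def)
  \<comment> \<open>Here \<open>shadow E \<subseteq> stable_shadow D \<subseteq> shadow G\<close>.
    By \<open>split\<close>, \<open>G\<close> then also maximizes the number of empty
    positions.\<close>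
  have le: "card (shadow E) \<le> card (shadow G)" if "E \<in> Min_KD D" for E
    using shadow_Min_KD_subset[OF that assms] G(3) finite_shadow[OF split(2)[OF G(1)]]
    by (intro card_mono) auto
  have "mc D = n"
    unfolding mc_def
  proof (rule Least_equality)
    show "\<exists>E \<in> Min_KD D. (D, E) \<in> nontrivial_move ^^ n" using G by blast
  next
    fix m assume "\<exists>E \<in> Min_KD D. (D, E) \<in> nontrivial_move ^^ m"
    then obtain E where E: "E \<in> Min_KD D" "(D, E) \<in> nontrivial_move ^^ m" by blast
    show "n \<le> m"
      using card_shadow_le_relpow[OF E(2) assms] le[OF E(1)] G(4) by simp
  qed
  moreover have "Max ((\<lambda>E. card (empty_cells E)) ` Min_KD D) = card (empty_cells G)"
    using G(1) le split(1) finite_Min_KD[OF assms] by (intro Max_eqI) fastforce+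
  ultimately show ?thesis
    using G(4) split(1)[OF G(1)] card_shadow[OF assms] by simp
qed

end
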